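(* For the Web graph $\mathbb{W}_{n}$ and every $n\ge 4$, $\operatorname{mdim}(\mathbb{W}_{n})=n+1$.
   Context: For an integer $n\ge 3$, the Web graph $\mathbb{W}_{n}$ has vertex set $\{p_i,q_i,r_i : 1\le i\le n\}$ and edge set $\{p_iq_i,\ p_ip_{i+1},\ q_iq_{i+1},\ q_ir_i : 1\le i\le n\}$, with indices taken modulo $n$. For a connected graph $H$, $d_H(u,v)$ is the shortest-path distance, and for a vertex $x$ and an edge $e=uv$, $d_H(x,e)=\min\{d_H(x,u),d_H(x,v)\}$. A set $M\subseteq V(H)$ is a mixed metric generator of $H$ if for every two distinct elements $y_1,y_2\in V(H)\cup E(H)$ there is a vertex $z\in M$ with $d_H(z,y_1)\ne d_H(z,y_2)$. The mixed metric dimension $\operatorname{mdim}(H)$ is the minimum cardinality of a mixed metric generator of $H$. *)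

theory Defs
  imports Main
begin

text \<open>A graph is given by its vertex set \<open>V\<close> and its set \<open>E\<close> of edges, an edge with
  endpoints \<open>u\<close> and \<open>v\<close> being the two-element set \<open>{u, v}\<close>.\<close>

definition is_path :: "'a set \<Rightarrow> 'a set set \<Rightarrow> 'a \<Rightarrow> 'a list \<Rightarrow> 'a \<Rightarrow> bool" where
  "is_path V E u xs v \<longleftrightarrow>
     xs \<noteq> [] \<and> hd xs = u \<and> last xs = v \<and> set xs \<subseteq> V \<and> distinct xs \<and>
     successively (\<lambda>x y. {x, y} \<in> E) xs"

text \<open>A path on \<open>k + 1\<close> vertices has length \<open>k\<close>. The value is meaningful only
  if \<open>u\<close> and \<open>v\<close> are joined by a path, in particular in every connected graph.\<close>

definition graph_dist :: "'a set \<Rightarrow> 'a set set \<Rightarrow> 'a \<Rightarrow> 'a \<Rightarrow> nat" where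
  "graph_dist V E u v = (LEAST k. \<exists>xs. is_path V E u xs v \<and> length xs = Suc k)"

definition edge_dist :: "'a set \<Rightarrow> 'a set set \<Rightarrow> 'a \<Rightarrow> 'a set \<Rightarrow> nat" where
  "edge_dist V E x e = Min (graph_dist V E x ` e)"

text \<open>The elements of \<open>V(H) \<union> E(H)\<close> are represented in the disjoint sum \<open>V <+> E\<close>:
  \<open>Inl v\<close> is a vertex and \<open>Inr e\<close> an edge.\<close>

fun mixed_dist :: "'a set \<Rightarrow> 'a set set \<Rightarrow> 'a \<Rightarrow> 'a + 'a set \<Rightarrow> nat" where
  "mixed_dist V E x (Inl v) = graph_dist V E x v"
| "mixed_dist V E x (Inr e) = edge_dist V E x e"

definition mixed_metric_generator :: "'a set \<Rightarrow> 'a set set \<Rightarrow> 'a set \<Rightarrow> bool" where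
  "mixed_metric_generator V E M \<longleftrightarrow>
     M \<subseteq> V \<and>
     (\<forall>y\<^sub>1 \<in> V <+> E. \<forall>y\<^sub>2 \<in> V <+> E. y\<^sub>1 \<noteq> y\<^sub>2 \<longrightarrow>
        (\<exists>z \<in> M. mixed_dist V E z y\<^sub>1 \<noteq> mixed_dist V E z y\<^sub>2))"

definition mdim :: "'a set \<Rightarrow> 'a set set \<Rightarrow> nat" where
  "mdim V E = (LEAST k. \<exists>M. mixed_metric_generator V E M \<and> finite M \<and> card M = k)"

datatype web_vertex = P nat | Q nat | R nat

definition web_verts :: "nat \<Rightarrow> web_vertex set" where
  "web_verts n = P ` {1..n} \<union> Q ` {1..n} \<union> R ` {1..n}"

text \<open>For \<open>i \<in> {1..n}\<close>, the index \<open>i + 1\<close> modulo \<open>n\<close>, as a representative in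
  \<open>{1..n}\<close>, is \<open>i mod n + 1\<close>.\<close>

definition web_edges :: "nat \<Rightarrow> web_vertex set set" where
  "web_edges n =
     (\<Union>i\<in>{1..n}. {{P i, Q i}, {P i, P (i mod n + 1)}, {Q i, Q (i mod n + 1)}, {Q i, R i}})"

end

theory Submission
  imports Defs
begin

text \<open>The only vertex that separates \<open>q\<^sub>i\<close> from the edge \<open>q\<^sub>ir\<^sub>i\<close> is \<open>r\<^sub>i\<close>, and only
  vertices \<open>p\<^sub>j\<close> separate \<open>q\<^sub>i\<close> from \<open>p\<^sub>iq\<^sub>i\<close>; hence a generator has at least \<open>n + 1\<close> elements.
  Conversely, the distances from \<open>r\<^sub>1, \<dots>, r\<^sub>n\<close> determine an element up to the pairs
  \<open>q\<^sub>i\<close>, \<open>p\<^sub>iq\<^sub>i\<close>: the least such distance gives the layer and the indices at which it is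
  attained give the position, while \<open>r\<^sub>i\<close> and \<open>q\<^sub>ir\<^sub>i\<close>, which agree in both, are separated by
  \<open>r\<^sub>i\<^sub>+\<^sub>1\<close>. Adding \<open>p\<^sub>1\<close> separates the remaining pairs.\<close>

section \<open>Certifying graph distances by local conditions\<close>

lemma successively_Lipschitz:
  fixes f :: "'a \<Rightarrow> nat"
  assumes "successively (\<lambda>x y. {x, y} \<in> E) xs" "xs \<noteq> []"
    and "\<And>x y. {x, y} \<in> E \<Longrightarrow> f y \<le> f x + 1"
  shows "f (last xs) + 1 \<le> f (hd xs) + length xs"
  using assms(1,2)
proof (induction xs rule: induct_list012)
  case (3 x y zs)
  then have "{x, y} \<in> E" "f (last (y # zs)) + 1 \<le> f y + length (y # zs)" by auto
  with assms(3)[of x y] show ?case by simp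
qed auto

text \<open>The Lipschitz condition makes \<open>f v\<close> a lower bound for the length of every
  path, and descending repeatedly to a neighbour with value smaller by one yields a path of exactly
  that length. A candidate distance formula thus needs to be checked only along edges.\<close>

lemma graph_dist_eqI:
  fixes f :: "'a \<Rightarrow> nat"
  assumes u: "u \<in> V" "f u = 0"
    and lip: "\<And>x y. {x, y} \<in> E \<Longrightarrow> f y \<le> f x + 1"
    and step: "\<And>v. v \<in> V \<Longrightarrow> v \<noteq> u \<Longrightarrow> \<exists>w\<in>V. {w, v} \<in> E \<and> f v = f w + 1"
    and v: "v \<in> V"
  shows "graph_dist V E u v = f v"
proof -
  \<comment> \<open>The bound on \<open>f\<close> along the path strengthens the induction: the
    appended vertex has a larger value than all earlier ones, so the extended list stays
    distinct.\<close>
  have ex: "\<exists>xs. is_path V E u xs v \<and> length xs = Suc (f v) \<and> (\<forall>x\<in>set xs. f x \<le> f v)"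
    using v
  proof (induction "f v" arbitrary: v rule: less_induct)
    case less
    show ?case
    proof (cases "v = u")
      case True
      then show ?thesis using u by (intro exI[of _ "[u]"]) (auto simp: is_path_def)
    next
      case False
      then obtain w where w: "w \<in> V" "{w, v} \<in> E" "f v = f w + 1"
        using step less.prems by blast
      then obtain xs where xs: "is_path V E u xs w" "length xs = Suc (f w)"
          "\<forall>x\<in>set xs. f x \<le> f w"
        using less.hyps by force
      moreover have "v \<notin> set xs" using xs(3) w(3) by auto
      ultimately have "is_path V E u (xs @ [v]) v"
        using less.prems w by (auto simp: is_path_def successively_append_iff)
      then show ?thesis
        using xs w by (intro exI[of _ "xs @ [v]"]) auto
    qed
  qed
  have "f v \<le> k" if "is_path V E u xs v" "length xs = Suc k" for xs k
    using successively_Lipschitz[of E xs f] that lip u by (auto simp: is_path_def)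
  with ex show ?thesis
    unfolding graph_dist_def by (intro Least_equality) blast+
qed

lemma edge_dist_doubleton:
  "edge_dist V E x {a, b} = min (graph_dist V E x a) (graph_dist V E x b)"
  by (simp add: edge_dist_def)

section \<open>Distance in a cycle\<close>

text \<open>With truncated subtraction, \<open>(k - i) + (i - k)\<close> is the absolute difference;
  the two arguments of \<open>min\<close> are the lengths of the two arcs between \<open>k\<close>
  and \<open>i\<close>.\<close>

definition cycle_dist :: "nat \<Rightarrow> nat \<Rightarrow> nat \<Rightarrow> nat" where
  "cycle_dist n k i = min ((k - i) + (i - k)) (n - ((k - i) + (i - k)))"

lemma cycle_succ_eq: "(i::nat) \<in> {1..n} \<Longrightarrow> i mod n + 1 = (if i = n then 1 else i + 1)"
  by auto

lemma cycle_succ_in: "(i::nat) \<in> {1..n} \<Longrightarrow> i mod n + 1 \<in> {1..n}"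
  by (simp only: cycle_succ_eq) auto

lemma cycle_dist_self [simp]: "cycle_dist n k k = 0"
  by (simp add: cycle_dist_def)

lemma cycle_dist_eq_0_iff:
  "k \<in> {1..n} \<Longrightarrow> i \<in> {1..n} \<Longrightarrow> cycle_dist n k i = 0 \<longleftrightarrow> k = i"
  by (auto simp: cycle_dist_def min_def split: if_splits)

lemma cycle_dist_succ:
  assumes "k \<in> {1..n}" "i \<in> {1..n}"
  shows "cycle_dist n k (i mod n + 1) \<le> cycle_dist n k i + 1"
    and "cycle_dist n k i \<le> cycle_dist n k (i mod n + 1) + 1"
proof -
  define d where "d j = (k - j) + (j - k)" for j
  \<comment> \<open>The last alternative is the step from \<open>n\<close> to \<open>1\<close>,
    where the absolute differences \<open>n - k\<close> and \<open>k - 1\<close> add up to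
    \<open>n - 1\<close>. There the two arcs exchange roles in the minimum.\<close>
  have "d i < n \<and> (d (i mod n + 1) = d i + 1 \<or> d i = d (i mod n + 1) + 1 \<or>
      d (i mod n + 1) + d i + 1 = n)"
    using assms unfolding cycle_succ_eq[OF assms(2)] d_def by auto
  then show "cycle_dist n k (i mod n + 1) \<le> cycle_dist n k i + 1"
    and "cycle_dist n k i \<le> cycle_dist n k (i mod n + 1) + 1"
    unfolding cycle_dist_def d_def[symmetric] by auto
qed

lemma cycle_dist_closer:
  assumes "k \<in> {1..n}" "i \<in> {1..n}" "k \<noteq> i"
  shows "\<exists>j\<in>{1..n}. (j = i mod n + 1 \<or> i = j mod n + 1) \<and> cycle_dist n k i = cycle_dist n k j + 1"
proof -
  \<comment> \<open>The cyclic predecessor of \<open>i\<close>. Together with the successor it gives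
    both neighbours of \<open>i\<close>, and one of them lies on a shortest arc to
    \<open>k\<close>.\<close>
  define j where "j = (if i = 1 then n else i - 1)"
  have j: "j \<in> {1..n}" "i = j mod n + 1"
    using assms by (auto simp: j_def)
  define d where "d l = (k - l) + (l - k)" for l
  have "d i < n" "d i > 0"
    using assms by (auto simp: d_def)
  moreover have "d i = d (i mod n + 1) + 1 \<and> (d j = d i + 1 \<or> d j + d i + 1 = n)" if "i < k"
    using assms that unfolding cycle_succ_eq[OF assms(2)] d_def j_def by auto
  moreover have "d i = d j + 1 \<and> (d (i mod n + 1) = d i + 1 \<or> d (i mod n + 1) + d i + 1 = n)"
    if "k < i"
    using assms that unfolding cycle_succ_eq[OF assms(2)] d_def j_def by auto
  ultimately have "cycle_dist n k i = cycle_dist n k j + 1 \<or>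
      cycle_dist n k i = cycle_dist n k (i mod n + 1) + 1"
    using assms(3) unfolding cycle_dist_def d_def[symmetric]
    by (cases "i < k") (auto simp: min_def)
  with cycle_succ_in[OF assms(2)] j show ?thesis by blast
qed

section \<open>Distances in the web graph\<close>

text \<open>Changing between the cycles or to a pendant vertex adds one per layer to the horizontal
  distance. The exception is \<open>R k\<close> to itself, where the detour through
  \<open>Q k\<close> disappears.\<close>

fun web_dist :: "nat \<Rightarrow> web_vertex \<Rightarrow> web_vertex \<Rightarrow> nat" where
  "web_dist n (P k) (P i) = cycle_dist n k i"
| "web_dist n (P k) (Q i) = cycle_dist n k i + 1"
| "web_dist n (P k) (R i) = cycle_dist n k i + 2"
| "web_dist n (Q k) (P i) = cycle_dist n k i + 1"
| "web_dist n (Q k) (Q i) = cycle_dist n k i"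
| "web_dist n (Q k) (R i) = cycle_dist n k i + 1"
| "web_dist n (R k) (P i) = cycle_dist n k i + 2"
| "web_dist n (R k) (Q i) = cycle_dist n k i + 1"
| "web_dist n (R k) (R i) = (if k = i then 0 else cycle_dist n k i + 2)"

lemma web_dist_Lipschitz:
  assumes "u \<in> web_verts n" "{x, y} \<in> web_edges n"
  shows "web_dist n u y \<le> web_dist n u x + 1"
proof -
  obtain k where k: "k \<in> {1..n}" "u = P k \<or> u = Q k \<or> u = R k"
    using assms(1) by (auto simp: web_verts_def)
  obtain i where i: "i \<in> {1..n}"
    "{x, y} \<in> {{P i, Q i}, {P i, P (i mod n + 1)}, {Q i, Q (i mod n + 1)}, {Q i, R i}}"
    using assms(2) unfolding web_edges_def by blast
  show ?thesis
    using k(2) i(2) cycle_dist_succ[OF k(1) i(1)]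
    by (auto simp: doubleton_eq_iff)
qed

lemma web_edgesI:
  assumes "i \<in> {1..n}"
  shows "{P i, Q i} \<in> web_edges n" "{P i, P (i mod n + 1)} \<in> web_edges n"
    "{Q i, Q (i mod n + 1)} \<in> web_edges n" "{Q i, R i} \<in> web_edges n"
  using assms unfolding web_edges_def by blast+

lemma web_dist_closer:
  assumes "u \<in> web_verts n" "v \<in> web_verts n" "v \<noteq> u"
  shows "\<exists>w\<in>web_verts n. {w, v} \<in> web_edges n \<and> web_dist n u v = web_dist n u w + 1"
proof -
  obtain k where k: "k \<in> {1..n}" "u = P k \<or> u = Q k \<or> u = R k"
    using assms(1) by (auto simp: web_verts_def)
  obtain i where i: "i \<in> {1..n}" "v = P i \<or> v = Q i \<or> v = R i"
    using assms(2) by (auto simp: web_verts_def)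
  have verts: "P j \<in> web_verts n" "Q j \<in> web_verts n" "R j \<in> web_verts n" if "j \<in> {1..n}" for j
    using that by (auto simp: web_verts_def)
  have horizontal: "\<exists>j\<in>{1..n}. {P j, P i} \<in> web_edges n \<and> {Q j, Q i} \<in> web_edges n \<and>
      cycle_dist n k i = cycle_dist n k j + 1" if "k \<noteq> i"
    using cycle_dist_closer[OF k(1) i(1) that] web_edgesI i(1) by (metis insert_commute)
  have vertical: "{P i, Q i} \<in> web_edges n" "{Q i, P i} \<in> web_edges n"
      "{Q i, R i} \<in> web_edges n" "{R i, Q i} \<in> web_edges n"
    using web_edgesI[OF i(1)] by (simp_all add: insert_commute)
  have *: ?thesis if "w \<in> web_verts n" "{w, v} \<in> web_edges n" "web_dist n u v = web_dist n u w + 1" for w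
    using that by blast
  \<comment> \<open>The cases select the last edge of a shortest path. It is horizontal if
    \<open>u\<close> and \<open>v\<close> lie on the same cycle, or if \<open>u = R k\<close> and
    \<open>v = Q i\<close> with \<open>k \<noteq> i\<close>; otherwise it is vertical at index
    \<open>i\<close>.\<close>
  consider "v = P i" "u = P k" | "v = Q i" "u = Q k" | "v = P i" "u \<noteq> P k"
    | "v = Q i" "u = P k" | "v = Q i" "u = R k" "k = i" | "v = Q i" "u = R k" "k \<noteq> i"
    | "v = R i"
    using k(2) i(2) by blast
  then show ?thesis
  proof cases
    case 1
    then show ?thesis using horizontal assms(3) verts by fastforce
  next
    case 2
    then show ?thesis using horizontal assms(3) verts by fastforce
  next
    case 3
    then show ?thesis using k(2) verts[OF i(1)] vertical by (intro *[of "Q i"]) auto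
  next
    case 4
    then show ?thesis using verts[OF i(1)] vertical by (intro *[of "P i"]) auto
  next
    case 5
    then show ?thesis using verts[OF i(1)] vertical by (intro *[of "R i"]) auto
  next
    case 6
    then show ?thesis using horizontal verts by fastforce
  next
    case 7
    then show ?thesis using k(2) assms(3) verts[OF i(1)] vertical by (intro *[of "Q i"]) (auto split: if_splits)
  qed
qed

lemma graph_dist_web:
  assumes "u \<in> web_verts n" "v \<in> web_verts n"
  shows "graph_dist (web_verts n) (web_edges n) u v = web_dist n u v"
proof (rule graph_dist_eqI)
  show "web_dist n u u = 0" by (cases u) auto
qed (use assms web_dist_Lipschitz web_dist_closer in auto)

lemma web_element_cases:
  assumes "y \<in> web_verts n <+> web_edges n"
  obtains i where "i \<in> {1..n}"
    "y \<in> {Inl (P i), Inl (Q i), Inl (R i), Inr {P i, Q i}, Inr {P i, P (i mod n + 1)},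
          Inr {Q i, Q (i mod n + 1)}, Inr {Q i, R i}}"
  using assms unfolding web_verts_def web_edges_def by auto

lemma mixed_dist_web:
  assumes "u \<in> web_verts n" "i \<in> {1..n}"
  shows "mixed_dist (web_verts n) (web_edges n) u (Inl (P i)) = web_dist n u (P i)"
    and "mixed_dist (web_verts n) (web_edges n) u (Inl (Q i)) = web_dist n u (Q i)"
    and "mixed_dist (web_verts n) (web_edges n) u (Inl (R i)) = web_dist n u (R i)"
    and "mixed_dist (web_verts n) (web_edges n) u (Inr {P i, Q i}) =
           min (web_dist n u (P i)) (web_dist n u (Q i))"
    and "mixed_dist (web_verts n) (web_edges n) u (Inr {Q i, R i}) =
           min (web_dist n u (Q i)) (web_dist n u (R i))"
    and "mixed_dist (web_verts n) (web_edges n) u (Inr {P i, P (i mod n + 1)}) =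
           min (web_dist n u (P i)) (web_dist n u (P (i mod n + 1)))"
    and "mixed_dist (web_verts n) (web_edges n) u (Inr {Q i, Q (i mod n + 1)}) =
           min (web_dist n u (Q i)) (web_dist n u (Q (i mod n + 1)))"
proof -
  have "P i \<in> web_verts n" "Q i \<in> web_verts n" "R i \<in> web_verts n"
      "P (i mod n + 1) \<in> web_verts n" "Q (i mod n + 1) \<in> web_verts n"
    using assms(2) cycle_succ_in[OF assms(2)] by (auto simp: web_verts_def)
  then show "mixed_dist (web_verts n) (web_edges n) u (Inl (P i)) = web_dist n u (P i)"
    and "mixed_dist (web_verts n) (web_edges n) u (Inl (Q i)) = web_dist n u (Q i)"
    and "mixed_dist (web_verts n) (web_edges n) u (Inl (R i)) = web_dist n u (R i)"
    and "mixed_dist (web_verts n) (web_edges n) u (Inr {P i, Q i}) =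
           min (web_dist n u (P i)) (web_dist n u (Q i))"
    and "mixed_dist (web_verts n) (web_edges n) u (Inr {Q i, R i}) =
           min (web_dist n u (Q i)) (web_dist n u (R i))"
    and "mixed_dist (web_verts n) (web_edges n) u (Inr {P i, P (i mod n + 1)}) =
           min (web_dist n u (P i)) (web_dist n u (P (i mod n + 1)))"
    and "mixed_dist (web_verts n) (web_edges n) u (Inr {Q i, Q (i mod n + 1)}) =
           min (web_dist n u (Q i)) (web_dist n u (Q (i mod n + 1)))"
    using graph_dist_web[OF assms(1)] by (simp_all add: edge_dist_doubleton)
qed

section \<open>Upper bound: what the pendant vertices detect\<close>

text \<open>Nonemptiness of \<open>S\<close> makes the lower bound \<open>l\<close> attained, hence
  the true minimum. So \<open>l\<close> and \<open>S\<close> are an invariant of the distances from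
  the pendant vertices.\<close>

definition nearest_R :: "nat \<Rightarrow> web_vertex + web_vertex set \<Rightarrow> nat \<Rightarrow> nat set \<Rightarrow> bool" where
  "nearest_R n y l S \<longleftrightarrow> S \<noteq> {} \<and> S \<subseteq> {1..n} \<and>
     (\<forall>k\<in>{1..n}. l \<le> mixed_dist (web_verts n) (web_edges n) (R k) y \<and>
        (mixed_dist (web_verts n) (web_edges n) (R k) y = l \<longleftrightarrow> k \<in> S))"

lemma nearest_R_unique:
  assumes "nearest_R n y l S" "nearest_R n z m T"
    and eq: "\<And>k. k \<in> {1..n} \<Longrightarrow> mixed_dist (web_verts n) (web_edges n) (R k) y =
      mixed_dist (web_verts n) (web_edges n) (R k) z"
  shows "l = m \<and> S = T"
proof -
  have "l = m"
  proof (rule antisym)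
    show "l \<le> m" using assms unfolding nearest_R_def by (metis ex_in_conv subsetD)
    show "m \<le> l" using assms unfolding nearest_R_def by (metis ex_in_conv subsetD)
  qed
  moreover have "k \<in> S \<longleftrightarrow> k \<in> T" if "k \<in> {1..n}" for k
    using assms(1,2) eq[OF that] that \<open>l = m\<close> unfolding nearest_R_def by metis
  moreover have "S \<subseteq> {1..n}" "T \<subseteq> {1..n}"
    using assms(1,2) unfolding nearest_R_def by simp_all
  ultimately show ?thesis by blast
qed

text \<open>Here \<open>f\<close> is the excess over the minimum; as a natural number it matters
  only through its zeros.\<close>

lemma nearest_RI:
  assumes "S \<noteq> {}" "S \<subseteq> {1..n}"
    and "\<And>k. k \<in> {1..n} \<Longrightarrow> mixed_dist (web_verts n) (web_edges n) (R k) y = l + f k"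
    and "\<And>k. k \<in> {1..n} \<Longrightarrow> f k = 0 \<longleftrightarrow> k \<in> S"
  shows "nearest_R n y l S"
  using assms unfolding nearest_R_def by simp

text \<open>An edge inherits the layer of its endpoint nearest to the pendant vertices, so a
  vertical edge agrees with that endpoint. A cycle edge attains its minimum at the indices of both
  endpoints.\<close>

lemma nearest_R_web:
  assumes i: "i \<in> {1..n}"
  shows "nearest_R n (Inl (R i)) 0 {i}" "nearest_R n (Inr {Q i, R i}) 0 {i}"
    "nearest_R n (Inl (Q i)) 1 {i}" "nearest_R n (Inr {P i, Q i}) 1 {i}"
    "nearest_R n (Inr {Q i, Q (i mod n + 1)}) 1 {i, i mod n + 1}"
    "nearest_R n (Inl (P i)) 2 {i}"
    "nearest_R n (Inr {P i, P (i mod n + 1)}) 2 {i, i mod n + 1}"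
proof -
  define a where "a = i mod n + 1"
  have a: "a \<in> {1..n}" using cycle_succ_in[OF i] by (simp add: a_def)
  have R: "R k \<in> web_verts n" if "k \<in> {1..n}" for k
    using that by (auto simp: web_verts_def)
  note dist = mixed_dist_web[OF R i, folded a_def]
  have zero: "cycle_dist n k i = 0 \<longleftrightarrow> k = i" "cycle_dist n k a = 0 \<longleftrightarrow> k = a"
    if "k \<in> {1..n}" for k
    by (rule cycle_dist_eq_0_iff[OF that i] cycle_dist_eq_0_iff[OF that a])+
  have S: "{i} \<noteq> {}" "{i} \<subseteq> {1..n}" "{i, a} \<noteq> {}" "{i, a} \<subseteq> {1..n}"
    using i a by simp_all
  show "nearest_R n (Inl (R i)) 0 {i}"
    by (rule nearest_RI[OF S(1,2), where f = "\<lambda>k. if k = i then 0 else cycle_dist n k i + 2"])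
      (simp_all only: dist web_dist.simps, auto)
  show "nearest_R n (Inr {Q i, R i}) 0 {i}"
    by (rule nearest_RI[OF S(1,2), where f = "\<lambda>k. if k = i then 0 else cycle_dist n k i + 1"])
      (simp_all only: dist web_dist.simps, auto)
  show "nearest_R n (Inl (Q i)) 1 {i}"
    by (rule nearest_RI[OF S(1,2), where f = "\<lambda>k. cycle_dist n k i"])
      (simp_all only: dist web_dist.simps zero, auto)
  show "nearest_R n (Inr {P i, Q i}) 1 {i}"
    by (rule nearest_RI[OF S(1,2), where f = "\<lambda>k. cycle_dist n k i"])
      (simp_all only: dist web_dist.simps zero, auto)
  show "nearest_R n (Inl (P i)) 2 {i}"
    by (rule nearest_RI[OF S(1,2), where f = "\<lambda>k. cycle_dist n k i"])
      (simp_all only: dist web_dist.simps zero, auto)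
  have min_zero: "min (cycle_dist n k i) (cycle_dist n k a) = 0 \<longleftrightarrow> k \<in> {i, a}"
    if "k \<in> {1..n}" for k
    using zero[OF that] by (auto simp: min_def)
  show "nearest_R n (Inr {Q i, Q (i mod n + 1)}) 1 {i, i mod n + 1}"
    unfolding a_def[symmetric]
    by (rule nearest_RI[OF S(3,4) _ min_zero])
      (simp_all only: dist web_dist.simps; simp add: min_def)
  show "nearest_R n (Inr {P i, P (i mod n + 1)}) 2 {i, i mod n + 1}"
    unfolding a_def[symmetric]
    by (rule nearest_RI[OF S(3,4) _ min_zero])
      (simp_all only: dist web_dist.simps; simp add: min_def)
qed

lemma mixed_metric_generator_web:
  assumes n: "n \<ge> 3"
  shows "mixed_metric_generator (web_verts n) (web_edges n) (insert (P 1) (R ` {1..n}))"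
    (is "mixed_metric_generator ?V ?E ?M")
proof -
  have "y = z" if y: "y \<in> ?V <+> ?E" and z: "z \<in> ?V <+> ?E"
    and eq: "\<And>u. u \<in> ?M \<Longrightarrow> mixed_dist ?V ?E u y = mixed_dist ?V ?E u z" for y z
  proof -
    let ?s = "\<lambda>i. i mod n + 1"
    \<comment> \<open>The flag \<open>w\<close> marks cycle edges, and \<open>C l w i\<close> lists
      the candidates with least distance \<open>l\<close> and index set \<open>S w i\<close>. Values
      of \<open>l\<close> other than 0 and 1 stand for the cycle of the \<open>P\<close>
      vertices.\<close>
    define S where "S w i = (if w then {i, ?s i} else {i})" for w i
    define C where "C l w i = (if l = 0 then {Inl (R i), Inr {Q i, R i}}
        else if l = 1 then (if w then {Inr {Q i, Q (?s i)}} else {Inl (Q i), Inr {P i, Q i}})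
        else (if w then {Inr {P i, P (?s i)}} else {Inl (P i)}))" for l :: nat and w i
    have layer: "\<exists>i\<in>{1..n}. \<exists>l w. nearest_R n y l (S w i) \<and> y \<in> C l w i"
      if y: "y \<in> ?V <+> ?E" for y
    proof -
      obtain i where i: "i \<in> {1..n}" "y \<in> {Inl (P i), Inl (Q i), Inl (R i), Inr {P i, Q i},
          Inr {P i, P (?s i)}, Inr {Q i, Q (?s i)}, Inr {Q i, R i}}"
        by (rule web_element_cases[OF y])
      have S: "{i} = S False i" "{i, ?s i} = S True i" by (auto simp: S_def)
      have C: "Inl (R i) \<in> C 0 False i" "Inr {Q i, R i} \<in> C 0 False i" "Inl (Q i) \<in> C 1 False i"
          "Inr {P i, Q i} \<in> C 1 False i" "Inr {Q i, Q (?s i)} \<in> C 1 True i"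
          "Inl (P i) \<in> C 2 False i" "Inr {P i, P (?s i)} \<in> C 2 True i"
        by (simp_all add: C_def)
      have "\<exists>l w. nearest_R n y l (S w i) \<and> y \<in> C l w i"
        using i(2) nearest_R_web[OF i(1), unfolded S] C by (elim insertE emptyE) blast+
      with i(1) show ?thesis by blast
    qed
    obtain i l w where i: "i \<in> {1..n}" "nearest_R n y l (S w i)" "y \<in> C l w i"
      using layer[OF y] by blast
    obtain j m v where j: "j \<in> {1..n}" "nearest_R n z m (S v j)" "z \<in> C m v j"
      using layer[OF z] by blast
    have lm: "l = m" "S w i = S v j"
      using nearest_R_unique[OF i(2) j(2)] eq by blast+
    \<comment> \<open>These facts recover \<open>w\<close> and \<open>i\<close> from
      \<open>S w i\<close>: singletons differ from pairs, and equal pairs with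
      \<open>i \<noteq> j\<close> would make \<open>i\<close> and \<open>j\<close> successors of
      each other, which fails for \<open>n \<ge> 3\<close>.\<close>
    have succ: "?s i \<noteq> i" "?s j \<noteq> j" "\<not> (?s i = j \<and> ?s j = i)"
      using n i(1) j(1) unfolding cycle_succ_eq[OF i(1)] cycle_succ_eq[OF j(1)] by auto
    have "i = j" "w = v"
      using lm(2) succ unfolding S_def by (auto simp: doubleton_eq_iff split: if_splits)
    with i(3) j(3) lm(1) have "y \<in> C l w i" "z \<in> C l w i" by simp_all
    then have "y \<in> {Inl (R i), Inr {Q i, R i}} \<and> z \<in> {Inl (R i), Inr {Q i, R i}} \<or>
        y \<in> {Inl (Q i), Inr {P i, Q i}} \<and> z \<in> {Inl (Q i), Inr {P i, Q i}} \<or> y = z"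
      unfolding C_def by (simp split: if_splits)
    \<comment> \<open>Any other pendant vertex reaches \<open>R i\<close> only through
      \<open>Q i\<close>, so it is one step closer to the edge than to \<open>R i\<close>.\<close>
    moreover have "mixed_dist ?V ?E (R (?s i)) (Inl (R i)) \<noteq> mixed_dist ?V ?E (R (?s i)) (Inr {Q i, R i})"
    proof -
      have "R (?s i) \<in> ?V" using cycle_succ_in[OF i(1)] unfolding web_verts_def by blast
      from mixed_dist_web[OF this i(1)] succ(1) show ?thesis by simp
    qed
    \<comment> \<open>Every vertex of the \<open>P\<close> cycle is one step closer to
      \<open>P i\<close> than to \<open>Q i\<close>, so the single vertex \<open>P 1\<close> serves
      all \<open>i\<close>.\<close>
    moreover have "mixed_dist ?V ?E (P 1) (Inl (Q i)) \<noteq> mixed_dist ?V ?E (P 1) (Inr {P i, Q i})"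
    proof -
      have "P 1 \<in> ?V" using n by (auto simp: web_verts_def)
      from mixed_dist_web[OF this i(1)] show ?thesis by simp
    qed
    moreover have "R (?s i) \<in> ?M" "P 1 \<in> ?M" using cycle_succ_in[OF i(1)] by blast+
    ultimately show ?thesis using eq[of "R (?s i)"] eq[of "P 1"] by (metis empty_iff insert_iff)
  qed
  moreover have "?M \<subseteq> ?V" using n by (auto simp: web_verts_def)
  ultimately show ?thesis
    unfolding mixed_metric_generator_def by blast
qed

section \<open>Lower bound: forced elements of a generator\<close>

text \<open>To separate \<open>Q i\<close> from its pendant edge, a vertex must be strictly closer
  to \<open>R i\<close> than to \<open>Q i\<close>. Since \<open>R i\<close> hangs on
  \<open>Q i\<close>, only \<open>R i\<close> itself qualifies.\<close>

lemma mixed_metric_generator_web_contains_R: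
  assumes "mixed_metric_generator (web_verts n) (web_edges n) M" "i \<in> {1..n}"
  shows "R i \<in> M"
proof -
  have "Inl (Q i) \<in> web_verts n <+> web_edges n" "Inr {Q i, R i} \<in> web_verts n <+> web_edges n"
    using web_edgesI[OF assms(2)] assms(2) by (auto simp: web_verts_def)
  then obtain z where z: "z \<in> M" "z \<in> web_verts n"
      "mixed_dist (web_verts n) (web_edges n) z (Inl (Q i)) \<noteq>
       mixed_dist (web_verts n) (web_edges n) z (Inr {Q i, R i})"
    using assms(1) unfolding mixed_metric_generator_def by blast
  then have "web_dist n z (R i) < web_dist n z (Q i)"
    using mixed_dist_web[OF z(2) assms(2)] by (simp add: min_def split: if_splits)
  then have "z = R i"
    by (cases z) (auto split: if_splits)
  with z(1) show ?thesis by simp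
qed

text \<open>Separating \<open>Q 1\<close> from the edge to \<open>P 1\<close> requires a vertex
  strictly closer to \<open>P 1\<close>; from the \<open>Q\<close> and \<open>R\<close> layers,
  \<open>P 1\<close> is one step further than \<open>Q 1\<close>.\<close>

lemma mixed_metric_generator_web_meets_P:
  assumes "mixed_metric_generator (web_verts n) (web_edges n) M" "n \<ge> 1"
  shows "\<exists>k. P k \<in> M"
proof -
  have 1: "1 \<in> {1..n}" using assms(2) by simp
  have "Inl (Q 1) \<in> web_verts n <+> web_edges n" "Inr {P 1, Q 1} \<in> web_verts n <+> web_edges n"
    using web_edgesI[OF 1] 1 by (auto simp: web_verts_def)
  then obtain z where z: "z \<in> M" "z \<in> web_verts n"
      "mixed_dist (web_verts n) (web_edges n) z (Inl (Q 1)) \<noteq>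
       mixed_dist (web_verts n) (web_edges n) z (Inr {P 1, Q 1})"
    using assms(1) unfolding mixed_metric_generator_def by blast
  then have "web_dist n z (P 1) < web_dist n z (Q 1)"
    using mixed_dist_web[OF z(2) 1] by (simp add: min_def split: if_splits)
  then have "\<exists>k. z = P k"
    by (cases z) auto
  with z(1) show ?thesis by blast
qed

theorem theorem7:
  fixes n :: nat
  assumes "n \<ge> 4"
  shows "mdim (web_verts n) (web_edges n) = n + 1"
proof -
  have card: "card (insert (P k) (R ` {1..n})) = n + 1" for k
    by (subst card_insert_disjoint) (auto simp: card_image inj_on_def)
  have lower: "n + 1 \<le> card M"
    if M: "mixed_metric_generator (web_verts n) (web_edges n) M" "finite M" for M
  proof -
    obtain k where "P k \<in> M"
      using mixed_metric_generator_web_meets_P[OF M(1)] assms by auto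
    then have "insert (P k) (R ` {1..n}) \<subseteq> M"
      using mixed_metric_generator_web_contains_R[OF M(1)] by blast
    then show ?thesis
      using card_mono[OF M(2)] card by metis
  qed
  show ?thesis
    unfolding mdim_def
  proof (rule Least_equality)
    show "\<exists>M. mixed_metric_generator (web_verts n) (web_edges n) M \<and> finite M \<and> card M = n + 1"
      using mixed_metric_generator_web[of n] card[of 1] assms
      by (intro exI[of _ "insert (P 1) (R ` {1..n})"]) simp
  qed (use lower in blast)
qed

end
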